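(* Suppose that a strongly convex function $f:\mathbb{R}^n\to\mathbb{R}$ has a strict local minimum $\bar{x}$. Then there exists $R>0$ such that for all $x$ satisfying $\|x-\bar{x}\|<R$, the third-order Taylor expansion $\Phi_{f,x}$ of $f$ around $x$ has a strict local minimum.
   Context: $\|\cdot\|$ is the Euclidean norm on $\mathbb{R}^n$. A point $x$ is a (strict) local minimum of a function $g:\mathbb{R}^n\to\mathbb{R}$ if there is $\epsilon>0$ with $g(x)\le g(y)$ (respectively $g(x)<g(y)$) for all $y\ne x$ with $\|y-x\|<\epsilon$. A function $f:\mathbb{R}^n\to\mathbb{R}$ is called strongly convex if there exists a constant $m>0$ such that $\nabla^2 f(x)\succeq mI$ for all $x\in\mathbb{R}^n$, where $I$ is the identity matrix and $A\succeq B$ means that $A-B$ is positive semidefinite. For a function $f$ and a point $\bar{z}\in\mathbb{R}^n$, $\Phi_{f,\bar{z}}$ denotes the third-order Taylor expansion of $f$ around $\bar{z}$, i.e. the polynomial in $z\in\mathbb{R}^n$ $$\Phi_{f,\bar{z}}(z)=f(\bar{z})+\nabla f(\bar{z})^T(z-\bar{z})+\tfrac12 (z-\bar{z})^T\nabla^2 f(\bar{z})(z-\bar{z})+\tfrac16\sum_{i=1}^n (z-\bar{z})^T(z-\bar{z})_i\,\nabla_i^3 f(\bar{z})(z-\bar{z}),$$ where $(z-\bar{z})_i$ is the $i$-th entry of $z-\bar{z}$ and $\nabla_i^3 f(\bar{z})$ is the $n\times n$ matrix whose $(j,k)$ entry is $\frac{\partial^3 f}{\partial x_i\partial x_j\partial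 x_k}(\bar{z})$.
   Formalization: The function f is assumed three times continuously differentiable on R^n; the statement leaves its smoothness unspecified, and with third derivatives that merely exist the claim fails (n=1, f''(x)=2+x^2 sin(x^-4), f'(0)=0). *)

theory Defs
  imports "HOL-Analysis.Analysis"
begin

definition partial_deriv :: "'n::finite \<Rightarrow> (real ^ 'n \<Rightarrow> real) \<Rightarrow> real ^ 'n \<Rightarrow> real"
  where "partial_deriv i f x = deriv (\<lambda>t. f (x + t *\<^sub>R axis i 1)) 0"

text \<open>Membership in the class C^k on the whole space. Since \<^const>\<open>deriv\<close> is a total function,
  differentiability has to be required explicitly at every order.\<close>

primrec Ck :: "nat \<Rightarrow> (real ^ 'n::finite \<Rightarrow> real) \<Rightarrow> bool" where
  "Ck 0 f \<longleftrightarrow> continuous_on UNIV f"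
| "Ck (Suc k) f \<longleftrightarrow> (\<forall>x. f differentiable (at x)) \<and> (\<forall>i. Ck k (partial_deriv i f))"

definition gradient :: "(real ^ 'n::finite \<Rightarrow> real) \<Rightarrow> real ^ 'n \<Rightarrow> real ^ 'n"
  where "gradient f x = (\<chi> i. partial_deriv i f x)"

definition hessian :: "(real ^ 'n::finite \<Rightarrow> real) \<Rightarrow> real ^ 'n \<Rightarrow> real ^ 'n ^ 'n"
  where "hessian f x = (\<chi> i j. partial_deriv i (partial_deriv j f) x)"

definition third_deriv :: "'n::finite \<Rightarrow> (real ^ 'n \<Rightarrow> real) \<Rightarrow> real ^ 'n \<Rightarrow> real ^ 'n ^ 'n"
  where "third_deriv i f x = (\<chi> j k. partial_deriv i (partial_deriv j (partial_deriv k f)) x)"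

text \<open>Symmetry of the matrix is not part of the definition; it is only applied to shifted
  Hessians, which are symmetric for functions of class C^2.\<close>

definition pos_semidef :: "real ^ 'n ^ 'n::finite \<Rightarrow> bool"
  where "pos_semidef A \<longleftrightarrow> (\<forall>v. 0 \<le> v \<bullet> (A *v v))"

definition strongly_convex :: "(real ^ 'n::finite \<Rightarrow> real) \<Rightarrow> bool"
  where "strongly_convex f \<longleftrightarrow> (\<exists>m>0. \<forall>x. pos_semidef (hessian f x - m *\<^sub>R mat 1))"

definition strict_local_min :: "(real ^ 'n::finite \<Rightarrow> real) \<Rightarrow> real ^ 'n \<Rightarrow> bool"
  where "strict_local_min g x \<longleftrightarrow>
    (\<exists>\<epsilon>>0. \<forall>y. y \<noteq> x \<and> norm (y - x) < \<epsilon> \<longrightarrow> g x < g y)"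

definition taylor3 :: "(real ^ 'n::finite \<Rightarrow> real) \<Rightarrow> real ^ 'n \<Rightarrow> real ^ 'n \<Rightarrow> real"
  where "taylor3 f w z =
    f w + gradient f w \<bullet> (z - w)
    + 1 / 2 * ((z - w) \<bullet> (hessian f w *v (z - w)))
    + 1 / 6 * (\<Sum>i\<in>UNIV. (z - w) \<bullet> ((z - w) $ i *\<^sub>R (third_deriv i f w *v (z - w))))"

end

theory Submission
  imports Defs
begin

text \<open>
  Write \<open>z = w + d\<close>. The expansion around \<open>w\<close> is a cubic polynomial in \<open>d\<close> whose linear part is
  small when \<open>w\<close> is near \<open>xbar\<close> (the gradient is continuous and vanishes at \<open>xbar\<close>), whose
  quadratic part is at least \<open>m / 2 * norm d ^ 2\<close> by strong convexity, and whose cubic part is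
  bounded by \<open>K / 6 * norm d ^ 3\<close> with \<open>K\<close> uniform in \<open>w\<close>, because the third derivatives are
  continuous. On a ball of radius \<open>r\<close> with \<open>K * r \<le> m / 2\<close> the quadratic part therefore wins twice.
  On the sphere the polynomial exceeds its value at the centre, so its minimum over the
  closed ball is attained in the open ball. Inside the ball it is strictly midpoint convex, so
  that this minimum is strict. Both facts are in \<open>cubic_strict_local_min\<close>, whose hypotheses are
  mere bounds on the coefficients of the cubic and hold with one choice of \<open>m\<close>, \<open>K\<close> and \<open>r\<close>
  for all \<open>w\<close> near \<open>xbar\<close>.
\<close>

definition trilinear :: "('n::finite \<Rightarrow> real ^ 'n ^ 'n) \<Rightarrow> real ^ 'n \<Rightarrow> real ^ 'n \<Rightarrow> real ^ 'n \<Rightarrow> real"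
  where "trilinear T x y z = (\<Sum>i\<in>UNIV. x $ i * (y \<bullet> (T i *v z)))"

definition cubic ::
  "real \<Rightarrow> real ^ 'n::finite \<Rightarrow> real ^ 'n ^ 'n \<Rightarrow> ('n \<Rightarrow> real ^ 'n ^ 'n) \<Rightarrow> real ^ 'n \<Rightarrow> real"
  where "cubic c g H T d = c + g \<bullet> d + 1 / 2 * (d \<bullet> (H *v d)) + 1 / 6 * trilinear T d d d"

lemma taylor3_eq_cubic:
  "taylor3 f w z = cubic (f w) (gradient f w) (hessian f w) (\<lambda>i. third_deriv i f w) (z - w)"
  by (simp add: taylor3_def cubic_def trilinear_def)

lemma trilinear_add_diff:
  "trilinear T (x + x') y z = trilinear T x y z + trilinear T x' y z"
  "trilinear T x (y + y') z = trilinear T x y z + trilinear T x y' z"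
  "trilinear T x y (z + z') = trilinear T x y z + trilinear T x y z'"
  "trilinear T (x - x') y z = trilinear T x y z - trilinear T x' y z"
  "trilinear T x (y - y') z = trilinear T x y z - trilinear T x y' z"
  "trilinear T x y (z - z') = trilinear T x y z - trilinear T x y z'"
  by (simp_all add: trilinear_def algebra_simps inner_simps matrix_vector_right_distrib
      matrix_vector_mult_diff_distrib sum.distrib sum_subtractf)

lemma abs_trilinear_le:
  "\<bar>trilinear T x y z\<bar>
    \<le> (\<Sum>i\<in>UNIV. \<Sum>j\<in>UNIV. \<Sum>k\<in>UNIV. \<bar>T i $ j $ k\<bar>) * (norm x * norm y * norm z)"
proof -
  have "\<bar>x $ i * (y \<bullet> (T i *v z))\<bar>
      \<le> (\<Sum>j\<in>UNIV. \<Sum>k\<in>UNIV. \<bar>T i $ j $ k\<bar>) * (norm x * norm y * norm z)" for i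
  proof -
    have "norm (T i *v z) \<le> onorm ((*v) (T i)) * norm z"
      by (intro onorm matrix_vector_mul_bounded_linear)
    also have "\<dots> \<le> (\<Sum>j\<in>UNIV. \<Sum>k\<in>UNIV. \<bar>T i $ j $ k\<bar>) * norm z"
      by (intro mult_right_mono onorm_le_matrix_component_sum norm_ge_zero)
    finally have "\<bar>y \<bullet> (T i *v z)\<bar> \<le> norm y * ((\<Sum>j\<in>UNIV. \<Sum>k\<in>UNIV. \<bar>T i $ j $ k\<bar>) * norm z)"
      by (meson Cauchy_Schwarz_ineq2 mult_left_mono norm_ge_zero order_trans)
    then have "\<bar>x $ i\<bar> * \<bar>y \<bullet> (T i *v z)\<bar>
        \<le> norm x * (norm y * ((\<Sum>j\<in>UNIV. \<Sum>k\<in>UNIV. \<bar>T i $ j $ k\<bar>) * norm z))"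
      by (intro mult_mono component_le_norm_cart) auto
    then show ?thesis by (simp add: abs_mult mult_ac)
  qed
  then show ?thesis
    unfolding trilinear_def sum_distrib_right
    by (intro order_trans[OF sum_abs] sum_mono) (simp add: sum_distrib_right)
qed

text \<open>In the second difference the constant, linear and odd terms cancel, which leaves the
  quadratic form at \<open>h\<close> and the part of the cubic form that is quadratic in \<open>h\<close>.\<close>

lemma cubic_second_difference:
  "cubic c g H T (e + h) + cubic c g H T (e - h) - 2 * cubic c g H T e
    = h \<bullet> (H *v h) + 1 / 3 * (trilinear T e h h + trilinear T h e h + trilinear T h h e)"
  by (simp add: cubic_def trilinear_add_diff inner_simps matrix_vector_right_distrib
      matrix_vector_mult_diff_distrib field_simps)

text \<open>The threshold \<open>m * r / 4\<close> on the linear part leaves room on the sphere, where the quadratic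
  and cubic parts together contribute at least \<open>(m / 2 - m / 12) * r ^ 2\<close>.\<close>

lemma cubic_strict_local_min:
  fixes H :: "real ^ 'n::finite ^ 'n"
  assumes H: "\<And>v. m * (norm v)\<^sup>2 \<le> v \<bullet> (H *v v)"
    and T: "\<And>x y z. \<bar>trilinear T x y z\<bar> \<le> K * (norm x * norm y * norm z)"
    and r: "0 < r" and m: "0 < m" and K: "0 \<le> K" "K * r \<le> m / 2" and g: "norm g < m * r / 4"
  shows "\<exists>d. strict_local_min (cubic c g H T) d"
proof -
  let ?p = "cubic c g H T"
  have cont: "continuous_on (cball 0 r) ?p"
    unfolding cubic_def trilinear_def
    by (intro continuous_intros linear_continuous_on matrix_vector_mul_bounded_linear)
  then obtain d where d: "d \<in> cball 0 r" and min: "\<And>y. y \<in> cball 0 r \<Longrightarrow> ?p d \<le> ?p y"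
    using continuous_attains_inf[of "cball 0 r" ?p] r by auto
  have "norm d \<noteq> r"
  proof
    assume nd: "norm d = r"
    have gd: "- (norm g * r) \<le> g \<bullet> d"
      using Cauchy_Schwarz_ineq2[of g d] nd by auto
    have "(K * r) * r\<^sup>2 \<le> m / 2 * r\<^sup>2" using K by (intro mult_right_mono) auto
    then have "\<bar>trilinear T d d d\<bar> \<le> m / 2 * r\<^sup>2"
      using T[of d d d] nd by (simp add: power2_eq_square mult_ac)
    moreover have "m * r\<^sup>2 \<le> d \<bullet> (H *v d)" using H[of d] nd by simp
    moreover have "norm g * r < m * r / 4 * r" using g r by (rule mult_strict_right_mono)
    moreover have "0 < m * r\<^sup>2" using m r by simp
    ultimately have "?p 0 < ?p d"
      using gd by (simp add: cubic_def trilinear_def power2_eq_square)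
    then show False using min[of 0] r by simp
  qed
  then have dr: "norm d < r" using d by simp
  \<comment> \<open>A competitor \<open>y\<close> no worse than \<open>d\<close> would make the midpoint \<open>e\<close> strictly better than \<open>d\<close>.\<close>
  have strict: "?p d < ?p y" if y: "y \<noteq> d" "norm (y - d) < r - norm d" for y
  proof -
    define e h where "e = (1/2) *\<^sub>R (d + y)" and "h = (1/2) *\<^sub>R (d - y)"
    have eh: "e + h = d" "e - h = y"
      by (simp_all add: e_def h_def vec_eq_iff field_simps)
    have "h \<noteq> 0" using y by (simp add: h_def)
    have "norm y \<le> norm d + norm (y - d)" using norm_triangle_sub[of y d] by simp
    then have "norm y < r" using y by simp
    then have e: "norm e < r" using dr norm_triangle_ineq[of d y] by (simp add: e_def)
    have "K * norm e \<le> K * r" using K e by (intro mult_left_mono) auto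
    then have "(K * norm e) * (norm h)\<^sup>2 \<le> m / 2 * (norm h)\<^sup>2"
      using K by (intro mult_right_mono) auto
    then have "- (m * (norm h)\<^sup>2 / 2) \<le> trilinear T e h h"
      "- (m * (norm h)\<^sup>2 / 2) \<le> trilinear T h e h"
      "- (m * (norm h)\<^sup>2 / 2) \<le> trilinear T h h e"
      using T[of e h h] T[of h e h] T[of h h e]
      by (simp_all add: abs_le_iff power2_eq_square mult_ac)
    moreover have "0 < m * (norm h)\<^sup>2" using m \<open>h \<noteq> 0\<close> by simp
    ultimately have "0 < ?p d + ?p y - 2 * ?p e"
      using H[of h] cubic_second_difference[of c g H T e h] unfolding eh by (simp add: algebra_simps)
    moreover have "?p d \<le> ?p e" using min[of e] e by simp
    ultimately show ?thesis by linarith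
  qed
  show ?thesis
    unfolding strict_local_min_def using dr strict
    by (intro exI[of _ d] exI[of _ "r - norm d"]) auto
qed

lemma strict_local_min_translate:
  assumes "strict_local_min p d"
  shows "strict_local_min (\<lambda>z. p (z - w)) (w + d)"
proof -
  obtain e where e: "e > 0" "\<And>y. y \<noteq> d \<Longrightarrow> norm (y - d) < e \<Longrightarrow> p d < p y"
    using assms unfolding strict_local_min_def by blast
  have "p d < p (y - w)" if "y \<noteq> w + d" "norm (y - (w + d)) < e" for y
    using e(2)[of "y - w"] that by (auto simp: algebra_simps)
  then show ?thesis unfolding strict_local_min_def using e(1) by auto
qed

lemma gradient_eq_0_if_strict_local_min:
  assumes "f differentiable (at x)" and "strict_local_min f x"
  shows "gradient f x = 0"
proof -
  obtain e where e: "e > 0" "\<And>y. y \<noteq> x \<Longrightarrow> norm (y - x) < e \<Longrightarrow> f x < f y"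
    using assms(2) unfolding strict_local_min_def by blast
  have "partial_deriv i f x = 0" for i
  proof -
    let ?l = "\<lambda>t::real. x + t *\<^sub>R axis i 1"
    have "?l differentiable (at 0)" by (intro derivative_intros)
    then have "(\<lambda>t. f (?l t)) differentiable (at 0)"
      using differentiable_chain_at[of ?l 0 f] assms(1) by (simp add: o_def)
    then have D: "DERIV (\<lambda>t. f (?l t)) 0 :> partial_deriv i f x"
      by (simp add: partial_deriv_def DERIV_deriv_iff_real_differentiable)
    have "f x \<le> f (?l t)" if "\<bar>t\<bar> < e" for t
      using e(2)[of "?l t"] that by (cases "?l t = x") auto
    then show ?thesis
      using DERIV_local_min[OF D e(1)] by simp
  qed
  then show ?thesis by (simp add: gradient_def vec_eq_iff)
qed

lemma continuous_on_if_Ck: "Ck k f \<Longrightarrow> continuous_on UNIV f"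
  by (cases k) (auto intro!: continuous_at_imp_continuous_on differentiable_imp_continuous_within)

theorem theorem3p1:
  fixes f :: "real ^ 'n::finite \<Rightarrow> real" and xbar :: "real ^ 'n"
  assumes "Ck 3 f"
    and "strongly_convex f"
    and "strict_local_min f xbar"
  shows "\<exists>R>0. \<forall>x. norm (x - xbar) < R \<longrightarrow> (\<exists>z. strict_local_min (taylor3 f x) z)"
proof -
  have diff: "f differentiable (at xbar)"
    using assms(1) by (simp add: eval_nat_numeral)
  have C1: "Ck 2 (partial_deriv i f)"
    and C3: "Ck 0 (partial_deriv i (partial_deriv j (partial_deriv k f)))" for i j k
    using assms(1) by (simp_all add: eval_nat_numeral)
  obtain m where m: "0 < m" and psd: "\<And>x. pos_semidef (hessian f x - m *\<^sub>R mat 1)"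
    using assms(2) unfolding strongly_convex_def by blast
  have H: "m * (norm v)\<^sup>2 \<le> v \<bullet> (hessian f x *v v)" for x v
    using psd[of x] unfolding pos_semidef_def
    by (simp add: matrix_vector_mult_diff_rdistrib scaleR_matrix_vector_assoc[symmetric]
        inner_simps power2_norm_eq_inner)
  define S where "S x = (\<Sum>i\<in>UNIV. \<Sum>j\<in>UNIV. \<Sum>k\<in>UNIV. \<bar>third_deriv i f x $ j $ k\<bar>)" for x
  have "continuous_on UNIV S"
    unfolding S_def third_deriv_def using C3 by (auto intro!: continuous_intros)
  then have S_lim: "(S \<longlongrightarrow> S xbar) (nhds xbar)"
    by (simp add: continuous_on_eq_continuous_at isCont_def tendsto_at_iff_tendsto_nhds)
  have "continuous_on UNIV (gradient f)"
    unfolding gradient_def using continuous_on_if_Ck[OF C1]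
    by (auto intro!: continuous_on_vec_lambda)
  then have "(gradient f \<longlongrightarrow> gradient f xbar) (nhds xbar)"
    by (simp add: continuous_on_eq_continuous_at isCont_def tendsto_at_iff_tendsto_nhds)
  then have g_lim: "((\<lambda>x. norm (gradient f x)) \<longlongrightarrow> 0) (nhds xbar)"
    using gradient_eq_0_if_strict_local_min[OF diff assms(3)] tendsto_norm by fastforce
  \<comment> \<open>The summand 1 gives a strict inequality at \<open>xbar\<close>, which persists nearby, and makes \<open>K\<close> positive.\<close>
  define K where "K = S xbar + 1"
  have K: "0 < K" unfolding K_def S_def by (intro add_nonneg_pos sum_nonneg) auto
  define r where "r = m / (2 * K)"
  have r: "0 < r" "K * r \<le> m / 2" using K m by (simp_all add: r_def)
  have "\<forall>\<^sub>F x in nhds xbar. S x < K \<and> norm (gradient f x) < m * r / 4"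
    using order_tendstoD(2)[OF S_lim, of K] order_tendstoD(2)[OF g_lim, of "m * r / 4"] m r
    by (simp add: K_def eventually_conj_iff)
  then obtain R where R: "0 < R"
    "\<And>x. norm (x - xbar) < R \<Longrightarrow> S x < K \<and> norm (gradient f x) < m * r / 4"
    unfolding eventually_nhds_metric dist_norm by blast
  have "\<exists>z. strict_local_min (taylor3 f x) z" if near: "norm (x - xbar) < R" for x
  proof -
    have "\<bar>trilinear (\<lambda>i. third_deriv i f x) u v w\<bar> \<le> K * (norm u * norm v * norm w)" for u v w
    proof -
      have "S x * (norm u * norm v * norm w) \<le> K * (norm u * norm v * norm w)"
        using R(2)[OF near] by (intro mult_right_mono) auto
      then show ?thesis
        using abs_trilinear_le[of "\<lambda>i. third_deriv i f x" u v w] unfolding S_def by linarith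
    qed
    then obtain d where "strict_local_min
        (cubic (f x) (gradient f x) (hessian f x) (\<lambda>i. third_deriv i f x)) d"
      using cubic_strict_local_min[OF H _ r(1) m _ r(2)] R(2)[OF near] K by (metis less_imp_le)
    from strict_local_min_translate[OF this, of x]
    show ?thesis by (auto simp: taylor3_eq_cubic[abs_def])
  qed
  with R(1) show ?thesis by blast
qed

end
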